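(* Let $K$ be an arbitrary (possibly infinite) index set and let $\mathcal{M} = (M_i \colon i \in K)$ be a family of matroids on a common ground set $E$ (possibly infinite), each of which is either finitary or cofinitary. Then $\mathcal{M}$ admits a base partitioning if and only if it admits both a base covering and a base packing.
   Context: Matroids here are possibly infinite: a matroid is a pair $(E,\mathcal{I})$ with $\mathcal{I}\subseteq\mathcal{P}(E)$ such that (1) $\emptyset\in\mathcal{I}$; (2) $\mathcal{I}$ is closed under subsets; (3) for all $I,B\in\mathcal{I}$ with $B$ maximal in $\mathcal{I}$ and $I$ not maximal, there is $x\in B\setminus I$ with $I\cup\{x\}\in\mathcal{I}$; (4) for every $X\subseteq E$, every $I\in\mathcal{I}$ with $I\subseteq X$ extends to a maximal element of $\mathcal{I}\cap\mathcal{P}(X)$. Independent sets are members of $\mathcal{I}$, bases are maximal independent sets, circuits are minimal dependent sets. The dual $M^*$ is the matroid on $E$ whose bases are the complements of the bases of $M$. $M$ is finitary if all its circuits are finite, and cofinitary if $M^*$ is finitary. For a family $(M_i\colon i\in K)$ on $E$, a family $(B_i\colon i\in K)$ with each $B_i$ a base of $M_i$ is a base covering if $\bigcup_i B_i=E$, a base packing if the $B_i$ are pairwise disjoint, and a base partitioning if $(B_i\colon i\in K)$ is a partition of $E$ (pairwise disjoint with union $E$). *)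

theory Defs
  imports Main
begin

text \<open>A (possibly infinite) matroid on ground set E, given by its independent sets,
  following the independence axioms (I1)-(I3) and (IM).\<close>

definition maximal_in :: "'a set set \<Rightarrow> 'a set \<Rightarrow> bool" where
  "maximal_in F X \<longleftrightarrow> X \<in> F \<and> (\<forall>Y\<in>F. X \<subseteq> Y \<longrightarrow> Y = X)"

definition matroid :: "'a set \<Rightarrow> 'a set set \<Rightarrow> bool" where
  "matroid E \<I> \<longleftrightarrow>
     (\<forall>I\<in>\<I>. I \<subseteq> E) \<and>
     {} \<in> \<I> \<and>
     (\<forall>I\<in>\<I>. \<forall>J. J \<subseteq> I \<longrightarrow> J \<in> \<I>) \<and>
     (\<forall>I\<in>\<I>. \<forall>B. maximal_in \<I> B \<longrightarrow> \<not> maximal_in \<I> I \<longrightarrow>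
         (\<exists>x\<in>B - I. insert x I \<in> \<I>)) \<and>
     (\<forall>X. X \<subseteq> E \<longrightarrow> (\<forall>I\<in>\<I>. I \<subseteq> X \<longrightarrow>
         (\<exists>J. I \<subseteq> J \<and> maximal_in {Y\<in>\<I>. Y \<subseteq> X} J)))"

definition bases :: "'a set set \<Rightarrow> 'a set set" where
  "bases \<I> = {B. maximal_in \<I> B}"

definition circuits :: "'a set \<Rightarrow> 'a set set \<Rightarrow> 'a set set" where
  "circuits E \<I> = {C. C \<subseteq> E \<and> C \<notin> \<I> \<and> (\<forall>D. D \<subset> C \<longrightarrow> D \<in> \<I>)}"

definition dual :: "'a set \<Rightarrow> 'a set set \<Rightarrow> 'a set set" where
  "dual E \<I> = {X. \<exists>B\<in>bases \<I>. X \<subseteq> E - B}"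

definition finitary :: "'a set \<Rightarrow> 'a set set \<Rightarrow> bool" where
  "finitary E \<I> \<longleftrightarrow> (\<forall>C\<in>circuits E \<I>. finite C)"

definition cofinitary :: "'a set \<Rightarrow> 'a set set \<Rightarrow> bool" where
  "cofinitary E \<I> \<longleftrightarrow> finitary E (dual E \<I>)"

definition base_covering :: "'a set \<Rightarrow> 'k set \<Rightarrow> ('k \<Rightarrow> 'a set set) \<Rightarrow> ('k \<Rightarrow> 'a set) \<Rightarrow> bool" where
  "base_covering E K M B \<longleftrightarrow> (\<forall>i\<in>K. B i \<in> bases (M i)) \<and> (\<Union>i\<in>K. B i) = E"

definition base_packing :: "'a set \<Rightarrow> 'k set \<Rightarrow> ('k \<Rightarrow> 'a set set) \<Rightarrow> ('k \<Rightarrow> 'a set) \<Rightarrow> bool" where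
  "base_packing E K M B \<longleftrightarrow> (\<forall>i\<in>K. B i \<in> bases (M i)) \<and>
     (\<forall>i\<in>K. \<forall>j\<in>K. i \<noteq> j \<longrightarrow> B i \<inter> B j = {})"

definition base_partitioning :: "'a set \<Rightarrow> 'k set \<Rightarrow> ('k \<Rightarrow> 'a set set) \<Rightarrow> ('k \<Rightarrow> 'a set) \<Rightarrow> bool" where
  "base_partitioning E K M B \<longleftrightarrow> (\<forall>i\<in>K. B i \<in> bases (M i)) \<and>
     (\<forall>i\<in>K. \<forall>j\<in>K. i \<noteq> j \<longrightarrow> B i \<inter> B j = {}) \<and> (\<Union>i\<in>K. B i) = E"

end

theory Submission
  imports Defs
begin

text \<open>The argument is a Gale-Shapley (stable matching) fixed point. Let \<open>P\<close> be a base packing and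
  shrink a base covering to a partition of \<open>E\<close> into independent sets \<open>I k\<close>. In a linearly ordered
  matroid the set \<open>D X\<close> of maxima of circuits inside \<open>X\<close> is monotone in \<open>X\<close>; if every circuit has a
  maximum and every cocircuit has a minimum, then \<open>X - D X\<close> is a base of \<open>X\<close>. Well-orders do this
  for finitary matroids and their converses for cofinitary ones. Let the \<open>k\<close>-th matroid
  prefer \<open>I k\<close> to \<open>P k\<close>, and let every element of \<open>E\<close> prefer the index that packs it to the
  index that covers it. Rejection by the matroids and rejection by the elements are both monotone,
  so Knaster-Tarski yields a stable outcome. No matroid rejects an element of its \<open>I k\<close>, so everything
  is covered, and no element rejects the index that packs it, so the chosen sets span.\<close>

section \<open>Maximality and the matroid axioms\<close>

lemma maximal_inI: "X \<in> F \<Longrightarrow> (\<And>Y. Y \<in> F \<Longrightarrow> X \<subseteq> Y \<Longrightarrow> Y = X) \<Longrightarrow> maximal_in F X"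
  by (auto simp: maximal_in_def)

lemma maximal_in_mem: "maximal_in F X \<Longrightarrow> X \<in> F"
  by (simp add: maximal_in_def)

lemma matroid_subset_ground: "matroid E \<I> \<Longrightarrow> I \<in> \<I> \<Longrightarrow> I \<subseteq> E"
  by (simp add: matroid_def)

lemma matroid_empty: "matroid E \<I> \<Longrightarrow> {} \<in> \<I>"
  by (simp add: matroid_def)

lemma matroid_hereditary:
  assumes "matroid E \<I>" "I \<in> \<I>" "J \<subseteq> I"
  shows "J \<in> \<I>"
proof -
  have "\<forall>I\<in>\<I>. \<forall>J. J \<subseteq> I \<longrightarrow> J \<in> \<I>"
    using assms(1) unfolding matroid_def by (elim conjE)
  then show ?thesis using assms(2,3) by blast
qed

lemma matroid_exchange:
  assumes "matroid E \<I>" "I \<in> \<I>" "maximal_in \<I> B" "\<not> maximal_in \<I> I"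
  obtains x where "x \<in> B" "x \<notin> I" "insert x I \<in> \<I>"
proof -
  have "\<forall>I\<in>\<I>. \<forall>B. maximal_in \<I> B \<longrightarrow> \<not> maximal_in \<I> I \<longrightarrow> (\<exists>x\<in>B - I. insert x I \<in> \<I>)"
    using assms(1) unfolding matroid_def by (elim conjE)
  then have "\<exists>x\<in>B - I. insert x I \<in> \<I>" using assms(2-4) by blast
  then show thesis using that by blast
qed

lemma matroid_extend:
  assumes "matroid E \<I>" "I \<in> \<I>" "I \<subseteq> X" "X \<subseteq> E"
  obtains J where "I \<subseteq> J" "maximal_in {Y\<in>\<I>. Y \<subseteq> X} J"
proof -
  have "\<forall>X. X \<subseteq> E \<longrightarrow> (\<forall>I\<in>\<I>. I \<subseteq> X \<longrightarrow> (\<exists>J. I \<subseteq> J \<and> maximal_in {Y\<in>\<I>. Y \<subseteq> X} J))"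
    using assms(1) unfolding matroid_def by (elim conjE)
  from this[rule_format, OF assms(4,2,3)] show thesis
    by (elim exE conjE) (rule that)
qed

lemma maximal_in_insert:
  assumes "matroid E \<I>" "maximal_in {Y\<in>\<I>. Y \<subseteq> X} B"
  shows "B \<in> \<I>" "B \<subseteq> X" "\<And>x. x \<in> X \<Longrightarrow> insert x B \<in> \<I> \<Longrightarrow> x \<in> B"
  using assms unfolding maximal_in_def by blast+

lemma maximal_in_restrictI:
  assumes "matroid E \<I>" "B \<in> \<I>" "B \<subseteq> X" "\<And>x. x \<in> X \<Longrightarrow> insert x B \<in> \<I> \<Longrightarrow> x \<in> B"
  shows "maximal_in {Y\<in>\<I>. Y \<subseteq> X} B"
proof (rule maximal_inI)
  show "B \<in> {Y\<in>\<I>. Y \<subseteq> X}" using assms by blast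
  fix Y assume Y: "Y \<in> {Y\<in>\<I>. Y \<subseteq> X}" "B \<subseteq> Y"
  have "x \<in> B" if "x \<in> Y" for x
    using assms(4)[of x] matroid_hereditary[OF assms(1), of Y "insert x B"] Y that by blast
  then show "Y = B" using Y by blast
qed

text \<open>Otherwise exchange with \<open>B\<close> would add to \<open>J\<close> an element of
  \<open>B\<close>, hence of \<open>X\<close>, against the maximality of \<open>J\<close> in
  \<open>X\<close>.\<close>

lemma maximal_in_spanning_superset:
  assumes m: "matroid E \<I>" and B: "maximal_in \<I> B" and J: "maximal_in {Y\<in>\<I>. Y \<subseteq> X} J"
    and sub: "B \<subseteq> X"
  shows "maximal_in \<I> J"
proof (rule ccontr)
  assume "\<not> maximal_in \<I> J"
  then obtain x where "x \<in> B" "x \<notin> J" "insert x J \<in> \<I>"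
    using matroid_exchange[OF m _ B] maximal_in_insert(1)[OF m J] by blast
  then show False using maximal_in_insert(3)[OF m J] sub by blast
qed

lemma matroid_extend_base:
  assumes m: "matroid E \<I>" and I: "I \<in> \<I>" and B: "maximal_in \<I> B"
  obtains J where "I \<subseteq> J" "J \<subseteq> I \<union> B" "maximal_in \<I> J"
proof -
  have "I \<union> B \<subseteq> E"
    using matroid_subset_ground[OF m] I B unfolding maximal_in_def by blast
  then obtain J where J: "I \<subseteq> J" "maximal_in {Y\<in>\<I>. Y \<subseteq> I \<union> B} J"
    using matroid_extend[OF m I, of "I \<union> B"] by blast
  then show thesis
    using that maximal_in_spanning_superset[OF m B J(2)] maximal_in_insert(2)[OF m J(2)] by blast
qed

lemma obtain_base_superset:
  assumes m: "matroid E \<I>" and I: "I \<in> \<I>"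
  obtains B where "I \<subseteq> B" "maximal_in \<I> B"
proof -
  have "{Y\<in>\<I>. Y \<subseteq> E} = \<I>" using matroid_subset_ground[OF m] by blast
  then show thesis
    using matroid_extend[OF m I, of E] matroid_subset_ground[OF m I] that by auto
qed

section \<open>Restriction to a subset of the ground set\<close>

text \<open>Exchange is the only axiom that takes work, and it is derived from bases of the whole
  matroid. A base \<open>B\<close> of \<open>Z\<close> extends to a base \<open>B'\<close> with no
  further elements in \<open>Z\<close>, and \<open>I\<close> extends to a base \<open>B1\<close>
  inside \<open>I \<union> B'\<close>; any new element of \<open>B1\<close> in \<open>Z\<close> then
  lies in \<open>B\<close>.\<close>

lemma matroid_restrict:
  assumes m: "matroid E \<I>" and Z: "Z \<subseteq> E"
  shows "matroid Z {Y\<in>\<I>. Y \<subseteq> Z}"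
  unfolding matroid_def
proof (intro conjI ballI allI impI)
  show "I \<subseteq> Z" if "I \<in> {Y\<in>\<I>. Y \<subseteq> Z}" for I using that by simp
next
  show "{} \<in> {Y\<in>\<I>. Y \<subseteq> Z}" using matroid_empty[OF m] by blast
next
  fix I J assume "I \<in> {Y\<in>\<I>. Y \<subseteq> Z}" "J \<subseteq> I"
  then show "J \<in> {Y\<in>\<I>. Y \<subseteq> Z}" using matroid_hereditary[OF m] by blast
next
  fix X I assume X: "X \<subseteq> Z" and I: "I \<in> {Y\<in>\<I>. Y \<subseteq> Z}" "I \<subseteq> X"
  have "I \<in> \<I>" "X \<subseteq> E" using I X Z by blast+
  then obtain J where J: "I \<subseteq> J" "maximal_in {Y\<in>\<I>. Y \<subseteq> X} J"
    using matroid_extend[OF m _ I(2)] by metis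
  have "{Y \<in> {Y\<in>\<I>. Y \<subseteq> Z}. Y \<subseteq> X} = {Y\<in>\<I>. Y \<subseteq> X}" using X by blast
  with J show "\<exists>J. I \<subseteq> J \<and> maximal_in {Y \<in> {Y\<in>\<I>. Y \<subseteq> Z}. Y \<subseteq> X} J"
    by (intro exI[of _ J]) simp
next
  fix I B
  assume I: "I \<in> {Y\<in>\<I>. Y \<subseteq> Z}" and B: "maximal_in {Y\<in>\<I>. Y \<subseteq> Z} B"
    and nmax: "\<not> maximal_in {Y\<in>\<I>. Y \<subseteq> Z} I"
  note Bs = maximal_in_insert[OF m B]
  obtain B' where B': "B \<subseteq> B'" "maximal_in \<I> B'"
    using obtain_base_superset[OF m Bs(1)] by blast
  have B'Z: "B' \<inter> Z \<subseteq> B"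
  proof
    fix x assume x: "x \<in> B' \<inter> Z"
    have "insert x B \<in> \<I>" using matroid_hereditary[OF m maximal_in_mem[OF B'(2)]] B'(1) x by blast
    then show "x \<in> B" using Bs(3) x by blast
  qed
  obtain B1 where B1: "I \<subseteq> B1" "B1 \<subseteq> I \<union> B'" "maximal_in \<I> B1"
    using matroid_extend_base[OF m _ B'(2), of I] I by blast
  show "\<exists>x\<in>B - I. insert x I \<in> {Y\<in>\<I>. Y \<subseteq> Z}"
  proof (cases "B1 \<inter> Z \<subseteq> I")
    case False
    then obtain x where x: "x \<in> B1" "x \<in> Z" "x \<notin> I" by blast
    then have "insert x I \<in> \<I>"
      using matroid_hereditary[OF m maximal_in_mem[OF B1(3)]] B1(1) by blast
    then show ?thesis using x B1 B'Z I by blast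
  next
    case True
    \<comment> \<open>Here \<open>B1\<close> adds nothing to \<open>I\<close> in \<open>Z\<close>,
      whereas \<open>J\<close> does. So a base \<open>B2\<close> inside \<open>J \<union> B1\<close>
      drops some \<open>y\<close> of \<open>B1\<close>, and \<open>y\<close> lies in
      \<open>B'\<close> outside \<open>Z\<close>. Extending \<open>B\<close> by elements of
      \<open>B2\<close> gives a base \<open>B3\<close> inside \<open>B'\<close> that misses
      \<open>y\<close>, which is impossible.\<close>
    obtain J where J: "I \<subset> J" "J \<in> \<I>" "J \<subseteq> Z" using I nmax unfolding maximal_in_def by blast
    obtain B2 where B2: "J \<subseteq> B2" "B2 \<subseteq> J \<union> B1" "maximal_in \<I> B2"
      using matroid_extend_base[OF m J(2) B1(3)] by blast
    have "\<not> B1 \<subseteq> B2"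
    proof
      assume "B1 \<subseteq> B2"
      then have "B2 = B1" using B1(3) B2(3) unfolding maximal_in_def by blast
      then show False using B2 J True by blast
    qed
    then obtain y where y: "y \<in> B1" "y \<notin> B2" by blast
    then have yZ: "y \<notin> Z" "y \<in> B'" using True J B2 B1 I by blast+
    obtain B3 where B3: "B \<subseteq> B3" "B3 \<subseteq> B \<union> B2" "maximal_in \<I> B3"
      using matroid_extend_base[OF m Bs(1) B2(3)] by blast
    have "B3 \<subseteq> B'"
    proof
      fix x assume x: "x \<in> B3"
      show "x \<in> B'"
      proof (cases "x \<in> Z")
        case True
        have "insert x B \<in> \<I>"
          using matroid_hereditary[OF m maximal_in_mem[OF B3(3)]] B3(1) x by blast
        then show ?thesis using Bs(3) True B' by blast
      next
        case False
        then show ?thesis using x B3 B2 J B1 I Bs(2) by blast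
      qed
    qed
    then have "B3 = B'" using B3(3) B'(2) unfolding maximal_in_def by blast
    then have False using y yZ B3 Bs(2) by blast
    then show ?thesis ..
  qed
qed

lemma restrict_exchange:
  assumes m: "matroid E \<I>" and "X \<subseteq> E" "maximal_in {Y\<in>\<I>. Y \<subseteq> X} B"
    "I \<in> \<I>" "I \<subseteq> X" "x \<in> X" "x \<notin> I" "insert x I \<in> \<I>"
  obtains y where "y \<in> B" "y \<notin> I" "insert y I \<in> \<I>"
proof -
  have nmax: "\<not> maximal_in {Y\<in>\<I>. Y \<subseteq> X} I"
    using maximal_in_insert(3)[OF m, of X I x] assms(6-8) by metis
  have I: "I \<in> {Y\<in>\<I>. Y \<subseteq> X}" using assms by simp
  obtain y where "y \<in> B" "y \<notin> I" "insert y I \<in> {Y\<in>\<I>. Y \<subseteq> X}"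
    by (rule matroid_exchange[OF matroid_restrict[OF m \<open>X \<subseteq> E\<close>] I assms(3) nmax])
  then show thesis using that by simp
qed

section \<open>Circuits\<close>

lemma circuit_not_subset_independent:
  assumes "matroid E \<I>" "I \<in> \<I>" "C \<in> circuits E \<I>"
  shows "\<not> C \<subseteq> I"
  using assms matroid_hereditary[OF assms(1,2), of C] by (auto simp: circuits_def)

text \<open>Descending through dependent subsets need not terminate in an infinite set, so the
  circuit is given explicitly: it is the fundamental circuit of some \<open>x\<close> over a maximal
  independent subset of \<open>X\<close>.\<close>

lemma dependent_contains_circuit:
  assumes m: "matroid E \<I>" and X: "X \<subseteq> E" "X \<notin> \<I>"
  obtains C where "C \<in> circuits E \<I>" "C \<subseteq> X"
proof -
  obtain B where B: "maximal_in {Y\<in>\<I>. Y \<subseteq> X} B"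
    using matroid_extend[OF m matroid_empty[OF m], of X] X by blast
  note Bs = maximal_in_insert[OF m B]
  have "B \<noteq> X" using Bs(1) X by blast
  then obtain x where x: "x \<in> X" "x \<notin> B" using Bs(2) by blast
  then have dep: "insert x B \<notin> \<I>" using Bs by blast
  have sub: "insert x B \<subseteq> E" using x Bs X by blast
  \<comment> \<open>The elements of the fundamental circuit are those whose deletion restores
    independence.\<close>
  define C where "C = {y \<in> insert x B. insert x B - {y} \<in> \<I>}"
  have "insert x B - {x} = B" using x by blast
  then have xC: "x \<in> C" using Bs by (simp add: C_def)
  have min: "D \<in> \<I>" if D: "D \<subset> C" for D
  proof -
    obtain y where y: "y \<in> C" "y \<notin> D" using D by blast
    have "D \<subseteq> insert x B - {y}" using D y unfolding C_def by blast
    then show ?thesis using matroid_hereditary[OF m] y unfolding C_def by blast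
  qed
  \<comment> \<open>A maximal independent \<open>B1\<close> above \<open>C\<close> would omit some
    \<open>y\<close> of \<open>B\<close>. Exchanging into \<open>B - {y}\<close> from
    \<open>B1\<close> can only bring in \<open>x\<close>, so deleting \<open>y\<close> restores
    independence and \<open>y\<close> belongs to \<open>C\<close> after all.\<close>
  have "C \<notin> \<I>"
  proof
    assume Ci: "C \<in> \<I>"
    have Cs: "C \<subseteq> insert x B" unfolding C_def by blast
    obtain B1 where B1: "C \<subseteq> B1" "maximal_in {Y\<in>\<I>. Y \<subseteq> insert x B} B1"
      by (rule matroid_extend[OF m Ci Cs sub])
    note B1s = maximal_in_insert[OF m B1(2)]
    have "B1 \<noteq> insert x B" using B1s(1) dep by blast
    then obtain y where y: "y \<in> insert x B" "y \<notin> B1" using B1s(2) by blast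
    then have yB: "y \<in> B" using xC B1 by blast
    have "B - {y} \<in> \<I>" using matroid_hereditary[OF m Bs(1)] by blast
    moreover have "insert y (B - {y}) = B" using yB by blast
    ultimately obtain w where w: "w \<in> B1" "w \<notin> B - {y}" "insert w (B - {y}) \<in> \<I>"
      using restrict_exchange[OF m sub B1(2), of "B - {y}" y] Bs(1) yB by auto
    then have "w = x" using y B1s by blast
    moreover have "insert x (B - {y}) = insert x B - {y}" using x yB by blast
    ultimately have "y \<in> C" using w y unfolding C_def by auto
    then show False using y B1 by blast
  qed
  then have "C \<in> circuits E \<I>" using min sub unfolding circuits_def C_def by blast
  moreover have "C \<subseteq> X" using x Bs unfolding C_def by blast
  ultimately show thesis using that by blast
qed

section \<open>Fundamental cocircuits\<close>

text \<open>The elements that can replace \<open>x\<close> in \<open>B\<close>, \<open>x\<close>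
  included. Phrasing this by independence avoids the dual of the restriction to
  \<open>X\<close>.\<close>

definition fund_cocircuit :: "'a set set \<Rightarrow> 'a set \<Rightarrow> 'a set \<Rightarrow> 'a \<Rightarrow> 'a set" where
  "fund_cocircuit \<I> X B x = {y\<in>X. y \<notin> B - {x} \<and> insert y (B - {x}) \<in> \<I>}"

lemma fund_cocircuit_mem_self:
  assumes "matroid E \<I>" "maximal_in {Y\<in>\<I>. Y \<subseteq> X} B" "x \<in> B"
  shows "x \<in> fund_cocircuit \<I> X B x"
  using maximal_in_insert[OF assms(1,2)] assms(3)
  unfolding fund_cocircuit_def by (auto simp: insert_absorb)

text \<open>Orthogonality of circuits and cocircuits. If they met in \<open>z\<close> alone,
  \<open>B - {x}\<close> would be maximal in its union \<open>?Z\<close> with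
  \<open>C - {z}\<close>. A maximal \<open>L\<close> in \<open>?Z\<close> above
  \<open>C - {z}\<close> cannot take in \<open>z\<close>, so it stays maximal once \<open>z\<close>
  joins \<open>?Z\<close>; as \<open>z\<close> does extend \<open>B - {x}\<close>, exchange yields
  an element of \<open>L\<close> that does too, a contradiction.\<close>

lemma circuit_inter_fund_cocircuit_ne_singleton:
  assumes m: "matroid E \<I>" and X: "X \<subseteq> E" and B: "maximal_in {Y\<in>\<I>. Y \<subseteq> X} B"
    and C: "C \<in> circuits E \<I>" "C \<subseteq> X"
  shows "C \<inter> fund_cocircuit \<I> X B x \<noteq> {z}"
proof
  assume meet: "C \<inter> fund_cocircuit \<I> X B x = {z}"
  note Bs = maximal_in_insert[OF m B]
  let ?A = "B - {x}" and ?Z = "(C - {z}) \<union> (B - {x})"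
  have z: "z \<in> C" "z \<in> X" "z \<notin> ?A" "insert z ?A \<in> \<I>"
    using meet unfolding fund_cocircuit_def by blast+
  have A: "?A \<in> \<I>" using matroid_hereditary[OF m Bs(1)] by blast
  have Amax: "y \<in> ?A" if "y \<in> ?Z" "insert y ?A \<in> \<I>" for y
    using meet that C Bs(2) unfolding fund_cocircuit_def by blast
  have ZX: "?Z \<subseteq> E" "insert z ?Z \<subseteq> E" using C Bs X z by blast+
  have "C - {z} \<subset> C" using z by blast
  then have "C - {z} \<in> \<I>" using C unfolding circuits_def by blast
  then obtain L where L: "C - {z} \<subseteq> L" "maximal_in {Y\<in>\<I>. Y \<subseteq> ?Z} L"
    using matroid_extend[OF m _ _ ZX(1), of "C - {z}"] by blast
  note Ls = maximal_in_insert[OF m L(2)]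
  have "insert z L \<notin> \<I>"
  proof
    assume "insert z L \<in> \<I>"
    moreover have "C \<subseteq> insert z L" using L by blast
    ultimately show False using circuit_not_subset_independent[OF m _ C(1)] by blast
  qed
  then have "maximal_in {Y\<in>\<I>. Y \<subseteq> insert z ?Z} L"
    using Ls by (intro maximal_in_restrictI[OF m]) blast+
  then obtain w where "w \<in> L" "w \<notin> ?A" "insert w ?A \<in> \<I>"
    using restrict_exchange[OF m ZX(2) _ A, of L z] z by blast
  then show False using Amax Ls(2) by blast
qed

text \<open>For \<open>X = E\<close> the fundamental cocircuit is a circuit of the dual; in general it is
  the trace on \<open>X\<close> of the one belonging to any base extending \<open>B\<close>.\<close>

lemma cofinitary_finite_fund_cocircuit:
  assumes m: "matroid E \<I>" and cof: "cofinitary E \<I>" and X: "X \<subseteq> E"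
    and B: "maximal_in {Y\<in>\<I>. Y \<subseteq> X} B" and x: "x \<in> B"
  shows "finite (fund_cocircuit \<I> X B x)"
proof -
  note Bs = maximal_in_insert[OF m B]
  obtain B' where B': "B \<subseteq> B'" "maximal_in \<I> B'"
    using obtain_base_superset[OF m Bs(1)] by blast
  have B'i: "B' \<in> \<I>" using B' unfolding maximal_in_def by blast
  let ?A = "B' - {x}"
  have A: "?A \<in> \<I>" using matroid_hereditary[OF m B'i] by blast
  have "B' \<noteq> ?A" using x B' by blast
  then have Anmax: "\<not> maximal_in \<I> ?A" using B'i unfolding maximal_in_def by blast
  let ?C = "fund_cocircuit \<I> E B' x"
  have "fund_cocircuit \<I> X B x \<subseteq> ?C"
  proof
    fix y assume "y \<in> fund_cocircuit \<I> X B x"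
    then have y: "y \<in> X" "y \<notin> B - {x}" "insert y (B - {x}) \<in> \<I>"
      unfolding fund_cocircuit_def by blast+
    show "y \<in> ?C"
    proof (cases "y = x")
      case True
      then show ?thesis using x B' B'i y X unfolding fund_cocircuit_def
        by (auto simp: insert_absorb)
    next
      case False
      then have yB: "y \<notin> B" using y by blast
      have yB': "y \<notin> B'"
      proof
        assume "y \<in> B'"
        then have "insert y B \<in> \<I>" using B' matroid_hereditary[OF m B'i] by blast
        then show False using Bs(3) y yB by blast
      qed
      \<comment> \<open>This base omits \<open>x\<close> because \<open>insert y B\<close> is
        dependent. Hence \<open>y\<close> is its only element that exchange can add to
        \<open>B' - {x}\<close>.\<close>
      obtain B2 where B2: "insert y (B - {x}) \<subseteq> B2" "B2 \<subseteq> insert y (B - {x}) \<union> B'"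
        "maximal_in \<I> B2"
        using matroid_extend_base[OF m y(3) B'(2)] by blast
      have "x \<notin> B2"
      proof
        assume "x \<in> B2"
        then have "insert y B \<subseteq> B2" using B2 by blast
        then have "insert y B \<in> \<I>"
          using matroid_hereditary[OF m maximal_in_mem[OF B2(3)]] by blast
        then show False using Bs(3) y yB by blast
      qed
      obtain w where "w \<in> B2" "w \<notin> ?A" "insert w ?A \<in> \<I>"
        using matroid_exchange[OF m A B2(3) Anmax] by blast
      moreover from this have "w = y" using B2 B' \<open>x \<notin> B2\<close> by blast
      ultimately show ?thesis using y X yB' unfolding fund_cocircuit_def by blast
    qed
  qed
  moreover have "?C \<in> circuits E (dual E \<I>)"
    unfolding circuits_def
  proof (intro CollectI conjI allI impI)
    show "?C \<subseteq> E" unfolding fund_cocircuit_def by blast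
    \<comment> \<open>Every base meets \<open>?C\<close>, since it supplies by exchange an element
      that extends \<open>B' - {x}\<close>.\<close>
    show "?C \<notin> dual E \<I>"
    proof
      assume "?C \<in> dual E \<I>"
      then obtain B2 where B2: "maximal_in \<I> B2" "?C \<subseteq> E - B2"
        unfolding dual_def bases_def by blast
      obtain w where w: "w \<in> B2" "w \<notin> ?A" "insert w ?A \<in> \<I>"
        using matroid_exchange[OF m A B2(1) Anmax] by blast
      then have "w \<in> ?C" using matroid_subset_ground[OF m w(3)]
        unfolding fund_cocircuit_def by blast
      then show False using B2 w by blast
    qed
    fix D assume D: "D \<subset> ?C"
    then obtain y where y: "y \<in> ?C" "y \<notin> D" by blast
    \<comment> \<open>Once \<open>y\<close> is removed, the rest of the cocircuit avoids the base
      obtained by swapping \<open>x\<close> for \<open>y\<close>.\<close>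
    let ?B = "insert y ?A"
    have yi: "?B \<in> \<I>" "y \<notin> ?A" using y unfolding fund_cocircuit_def by blast+
    have "maximal_in \<I> ?B"
    proof (rule ccontr)
      assume "\<not> maximal_in \<I> ?B"
      then obtain w where w: "w \<in> B'" "w \<notin> ?B" "insert w ?B \<in> \<I>"
        using matroid_exchange[OF m yi(1) B'(2)] by blast
      then have "w = x" "y \<noteq> x" by blast+
      then have "insert w ?B = insert y B'" "y \<notin> B'" using w yi by blast+
      then show False using w B'(2) unfolding maximal_in_def by auto
    qed
    moreover have "D \<subseteq> E - ?B" using D y unfolding fund_cocircuit_def by blast
    ultimately show "D \<in> dual E \<I>" unfolding dual_def bases_def by blast
  qed
  ultimately show ?thesis
    using cof finite_subset unfolding cofinitary_def finitary_def by blast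
qed

section \<open>Preference orders and rejection\<close>

text \<open>Minima of all nonempty sets and maxima of the finite ones are what the finitary case
  needs for cocircuits and circuits; the converse order swaps the two roles for the cofinitary
  case.\<close>

lemma wellorder_with_initial_segment:
  fixes A :: "'a set"
  obtains le :: "'a \<Rightarrow> 'a \<Rightarrow> bool" where
    "\<And>S. S \<noteq> {} \<Longrightarrow> \<exists>z\<in>S. \<forall>y\<in>S. le z y"
    "\<And>S. finite S \<Longrightarrow> S \<noteq> {} \<Longrightarrow> \<exists>z\<in>S. \<forall>y\<in>S. le y z"
    "\<And>x y. le x y \<Longrightarrow> le y x \<Longrightarrow> x = y"
    "\<And>x y. le x y \<Longrightarrow> y \<in> A \<Longrightarrow> x \<in> A"
proof -
  obtain r :: "'a rel" where r: "Well_order r" "Field r = UNIV"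
    using well_ordering by metis
  have anti: "antisym r" and trans: "trans r"
    using r unfolding order_on_defs by blast+
  have r_min: "\<exists>z\<in>S. \<forall>y\<in>S. (z, y) \<in> r" if "S \<noteq> {}" for S
    using r that wo_rel.minim_in[of r S] wo_rel.minim_least[of r S] unfolding wo_rel_def by blast
  \<comment> \<open>The ordinal sum of \<open>A\<close> and its complement, each ordered by
    \<open>r\<close>.\<close>
  define le where "le x y \<longleftrightarrow> x \<in> A \<and> y \<notin> A \<or> (x \<in> A \<longleftrightarrow> y \<in> A) \<and> (x, y) \<in> r" for x y
  have min: "\<exists>z\<in>S. \<forall>y\<in>S. le z y" if "S \<noteq> {}" for S
  proof (cases "S \<inter> A = {}")
    case True
    then show ?thesis using r_min[OF that] unfolding le_def by blast
  next
    case False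
    then show ?thesis using r_min[OF False] unfolding le_def by blast
  qed
  have le_trans: "le x z" if "le x y" "le y z" for x y z
    using that trans unfolding le_def trans_def by blast
  have total: "le x y \<or> le y x" for x y using min[of "{x, y}"] by auto
  have max: "\<exists>z\<in>S. \<forall>y\<in>S. le y z" if "finite S" "S \<noteq> {}" for S
    using that
  proof (induction rule: finite_ne_induct)
    case (singleton x)
    then show ?case using total by auto
  next
    case (insert x S)
    then obtain z where "z \<in> S" "\<forall>y\<in>S. le y z" by blast
    then show ?case using total le_trans by (metis insert_iff)
  qed
  show thesis
  proof (rule that[of le])
    show "x = y" if "le x y" "le y x" for x y
      using that anti unfolding le_def antisym_def by blast
    show "x \<in> A" if "le x y" "y \<in> A" for x y
      using that unfolding le_def by blast
  qed (fact min, fact max)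
qed

text \<open>Smaller in \<open>le\<close> means preferred: these are the elements that a greedy
  choice from \<open>X\<close> would skip. The formulation by circuits also makes sense where a
  greedy recursion cannot start, as for the converse of a well-order.\<close>

definition rejected :: "'a set \<Rightarrow> 'a set set \<Rightarrow> ('a \<Rightarrow> 'a \<Rightarrow> bool) \<Rightarrow> 'a set \<Rightarrow> 'a set" where
  "rejected E \<I> le X = {x. \<exists>C\<in>circuits E \<I>. C \<subseteq> X \<and> x \<in> C \<and> (\<forall>y\<in>C. le y x)}"

lemma rejected_mono: "X \<subseteq> Y \<Longrightarrow> rejected E \<I> le X \<subseteq> rejected E \<I> le Y"
  unfolding rejected_def by (intro Collect_mono impI) (meson subset_trans)

text \<open>A circuit with its maximum in the initial segment \<open>A\<close> lies wholly in
  \<open>A\<close>.\<close>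

lemma rejected_disjoint_initial_independent:
  assumes m: "matroid E \<I>" and A: "A \<in> \<I>" and init: "\<And>x y. le x y \<Longrightarrow> y \<in> A \<Longrightarrow> x \<in> A"
  shows "rejected E \<I> le X \<inter> A = {}"
proof (rule ccontr)
  assume "rejected E \<I> le X \<inter> A \<noteq> {}"
  then obtain C where C: "C \<in> circuits E \<I>" "C \<subseteq> A" using init unfolding rejected_def by blast
  then show False using circuit_not_subset_independent[OF m A] by blast
qed

text \<open>A circuit among the kept elements would have its maximum rejected, so they are
  independent. If a larger \<open>B\<close> gained \<open>x\<close>, the minimum \<open>z\<close> of
  the fundamental cocircuit of \<open>x\<close> would be rejected, as the maximum of some circuit.
  That circuit and the cocircuit meet only in \<open>z\<close>, against orthogonality.\<close>

lemma maximal_in_minus_rejected: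
  assumes m: "matroid E \<I>" and X: "X \<subseteq> E"
    and anti: "\<And>x y. le x y \<Longrightarrow> le y x \<Longrightarrow> x = y"
    and max: "\<And>C. C \<in> circuits E \<I> \<Longrightarrow> \<exists>z\<in>C. \<forall>y\<in>C. le y z"
    and min: "\<And>B x. maximal_in {Y\<in>\<I>. Y \<subseteq> X} B \<Longrightarrow> x \<in> B \<Longrightarrow>
      \<exists>z\<in>fund_cocircuit \<I> X B x. \<forall>y\<in>fund_cocircuit \<I> X B x. le z y"
  shows "maximal_in {Y\<in>\<I>. Y \<subseteq> X} (X - rejected E \<I> le X)"
proof -
  let ?J = "X - rejected E \<I> le X"
  have J: "?J \<in> \<I>"
  proof (rule ccontr)
    assume "?J \<notin> \<I>"
    then obtain C where C: "C \<in> circuits E \<I>" "C \<subseteq> ?J"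
      using dependent_contains_circuit[OF m, of ?J] X by blast
    obtain z where "z \<in> C" "\<forall>y\<in>C. le y z" using max[OF C(1)] by blast
    then have "z \<in> rejected E \<I> le X" using C unfolding rejected_def by blast
    then show False using C \<open>z \<in> C\<close> by blast
  qed
  then obtain B where B: "?J \<subseteq> B" "maximal_in {Y\<in>\<I>. Y \<subseteq> X} B"
    using matroid_extend[OF m _ _ X, of ?J] by blast
  have "B \<subseteq> ?J"
  proof (rule ccontr)
    assume "\<not> B \<subseteq> ?J"
    then obtain x where x: "x \<in> B" "x \<notin> ?J" by blast
    let ?C = "fund_cocircuit \<I> X B x"
    obtain z where z: "z \<in> ?C" "\<forall>y\<in>?C. le z y" using min[OF B(2) x(1)] by blast
    have "z \<notin> ?J" using z x B unfolding fund_cocircuit_def by blast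
    then have "z \<in> rejected E \<I> le X" using z unfolding fund_cocircuit_def by blast
    then obtain C where C: "C \<in> circuits E \<I>" "C \<subseteq> X" "z \<in> C" "\<forall>y\<in>C. le y z"
      unfolding rejected_def by blast
    then have "C \<inter> ?C = {z}" using z anti by blast
    then show False using circuit_inter_fund_cocircuit_ne_singleton[OF m X B(2) C(1,2)] by blast
  qed
  then show ?thesis using B by (metis subset_antisym)
qed

text \<open>Hides the order and keeps what the fixed point argument uses of it; \<open>A\<close> is
  the preferred set.\<close>

lemma monotone_rejection_exists:
  assumes m: "matroid E \<I>" and fc: "finitary E \<I> \<or> cofinitary E \<I>" and A: "A \<in> \<I>"
  shows "\<exists>D. (\<forall>X Y. X \<subseteq> Y \<longrightarrow> D X \<subseteq> D Y) \<and> (\<forall>X. D X \<inter> A = {}) \<and>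
    (\<forall>X\<subseteq>E. maximal_in {Y\<in>\<I>. Y \<subseteq> X} (X - D X))"
proof -
  have circ_ne: "C \<noteq> {}" if "C \<in> circuits E \<I>" for C
    using that matroid_empty[OF m] unfolding circuits_def by blast
  have cocirc_ne: "fund_cocircuit \<I> X B x \<noteq> {}"
    if "maximal_in {Y\<in>\<I>. Y \<subseteq> X} B" "x \<in> B" for X B x
    using fund_cocircuit_mem_self[OF m that] by blast
  have "\<exists>le. (\<forall>x y. le x y \<longrightarrow> y \<in> A \<longrightarrow> x \<in> A) \<and>
      (\<forall>X\<subseteq>E. maximal_in {Y\<in>\<I>. Y \<subseteq> X} (X - rejected E \<I> le X))"
    using fc
  proof
    assume fin: "finitary E \<I>"
    obtain le where le: "\<And>S. S \<noteq> {} \<Longrightarrow> \<exists>z\<in>S. \<forall>y\<in>S. le z y"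
      "\<And>S. finite S \<Longrightarrow> S \<noteq> {} \<Longrightarrow> \<exists>z\<in>S. \<forall>y\<in>S. le y z"
      "\<And>x y. le x y \<Longrightarrow> le y x \<Longrightarrow> x = y" "\<And>x y. le x y \<Longrightarrow> y \<in> A \<Longrightarrow> x \<in> A"
      using that by (rule wellorder_with_initial_segment[of A])
    have "maximal_in {Y\<in>\<I>. Y \<subseteq> X} (X - rejected E \<I> le X)" if "X \<subseteq> E" for X
      using fin
      by (intro maximal_in_minus_rejected[OF m that le(3)] le(1,2) circ_ne cocirc_ne)
        (auto simp: finitary_def)
    then show ?thesis using le(4) by blast
  next
    assume cof: "cofinitary E \<I>"
    \<comment> \<open>The order will be reversed, so the complement of \<open>A\<close> has to come
      first here.\<close>
    obtain le where le: "\<And>S. S \<noteq> {} \<Longrightarrow> \<exists>z\<in>S. \<forall>y\<in>S. le z y"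
      "\<And>S. finite S \<Longrightarrow> S \<noteq> {} \<Longrightarrow> \<exists>z\<in>S. \<forall>y\<in>S. le y z"
      "\<And>x y. le x y \<Longrightarrow> le y x \<Longrightarrow> x = y" "\<And>x y. le x y \<Longrightarrow> y \<in> - A \<Longrightarrow> x \<in> - A"
      using that by (rule wellorder_with_initial_segment[of "- A"])
    let ?ge = "\<lambda>x y. le y x"
    have "maximal_in {Y\<in>\<I>. Y \<subseteq> X} (X - rejected E \<I> ?ge X)" if "X \<subseteq> E" for X
      by (intro maximal_in_minus_rejected[OF m that le(3)] le(1,2) circ_ne cocirc_ne
          cofinitary_finite_fund_cocircuit[OF m cof that])
    moreover have "\<forall>x y. ?ge x y \<longrightarrow> y \<in> A \<longrightarrow> x \<in> A" using le(4) by blast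
    ultimately show ?thesis by (intro exI[of _ ?ge]) blast
  qed
  then obtain le where "\<forall>x y. le x y \<longrightarrow> y \<in> A \<longrightarrow> x \<in> A"
    "\<forall>X\<subseteq>E. maximal_in {Y\<in>\<I>. Y \<subseteq> X} (X - rejected E \<I> le X)" by blast
  then show ?thesis
    using rejected_disjoint_initial_independent[OF m A, of le] rejected_mono[of _ _ E \<I> le]
    by (intro exI[of _ "rejected E \<I> le"]) blast
qed

section \<open>The stable outcome\<close>

lemma base_partitioning_from_packing_covering:
  fixes E :: "'a set" and K :: "'k set" and M :: "'k \<Rightarrow> 'a set set"
  assumes m: "\<forall>i\<in>K. matroid E (M i)" and fc: "\<forall>i\<in>K. finitary E (M i) \<or> cofinitary E (M i)"
    and P: "base_packing E K M P" and Q: "base_covering E K M Q"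
  shows "\<exists>B. base_partitioning E K M B"
proof -
  have Pb: "maximal_in (M k) (P k)" and Qi: "Q k \<in> M k" if "k \<in> K" for k
    using P Q that unfolding base_packing_def base_covering_def bases_def maximal_in_def by blast+
  have Pdisj: "j = k" if "j \<in> K" "k \<in> K" "e \<in> P j" "e \<in> P k" for j k e
    using P that unfolding base_packing_def by blast
  have PE: "P k \<subseteq> E" and QE: "Q k \<subseteq> E" if "k \<in> K" for k
    using that m matroid_subset_ground Pb Qi unfolding maximal_in_def by blast+
  have "\<forall>e\<in>E. \<exists>k\<in>K. e \<in> Q k" using Q unfolding base_covering_def by blast
  then obtain c where c: "\<And>e. e \<in> E \<Longrightarrow> c e \<in> K \<and> e \<in> Q (c e)" by metis
  define I where "I k = {e\<in>E. c e = k}" for k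
  have Ii: "I k \<in> M k" if "k \<in> K" for k
    using matroid_hereditary[of E "M k" "Q k" "I k"] m Qi c that unfolding I_def by blast
  have "\<forall>k\<in>K. \<exists>D. (\<forall>X Y. X \<subseteq> Y \<longrightarrow> D X \<subseteq> D Y) \<and> (\<forall>X. D X \<inter> I k = {}) \<and>
    (\<forall>X\<subseteq>E. maximal_in {Y\<in>M k. Y \<subseteq> X} (X - D X))"
  proof
    fix k assume "k \<in> K"
    then show "\<exists>D. (\<forall>X Y. X \<subseteq> Y \<longrightarrow> D X \<subseteq> D Y) \<and> (\<forall>X. D X \<inter> I k = {}) \<and>
      (\<forall>X\<subseteq>E. maximal_in {Y\<in>M k. Y \<subseteq> X} (X - D X))"
      using m fc Ii by (intro monotone_rejection_exists) simp_all
  qed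
  from bchoice[OF this] obtain D where D:
    "\<forall>k\<in>K. (\<forall>X Y. X \<subseteq> Y \<longrightarrow> D k X \<subseteq> D k Y) \<and> (\<forall>X. D k X \<inter> I k = {}) \<and>
      (\<forall>X\<subseteq>E. maximal_in {Y\<in>M k. Y \<subseteq> X} (X - D k X))"
    by (elim exE) (rule that)
  have D_mono: "D k X \<subseteq> D k Y" if "k \<in> K" "X \<subseteq> Y" for k X Y
    using D that by simp
  have D_I: "D k X \<inter> I k = {}" if "k \<in> K" for k X
    using D that by simp
  have D_base: "maximal_in {Y\<in>M k. Y \<subseteq> X} (X - D k X)" if "k \<in> K" "X \<subseteq> E" for k X
    using D that by simp
  \<comment> \<open>\<open>U k\<close> holds the only elements ever paired with \<open>k\<close>. In
    what follows, \<open>X k\<close> are those that do not reject \<open>k\<close>, and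
    \<open>Y k\<close> those that \<open>k\<close> does not reject.\<close>
  define U where "U k = (if k \<in> K then I k \<union> P k else {})" for k
  \<comment> \<open>An element turns \<open>k\<close> down exactly when \<open>k\<close> does not
    pack it and the index that does pack it wants it.\<close>
  define R where "R Y k = {e \<in> Y k. e \<notin> P k \<and> (\<exists>j\<in>K. e \<in> P j \<and> e \<in> Y j)}" for Y :: "'k \<Rightarrow> 'a set" and k
  define G where "G X k = (if k \<in> K then U k - D k (X k) else {})" for X :: "'k \<Rightarrow> 'a set" and k
  define F where "F X k = U k - R (G X) k" for X :: "'k \<Rightarrow> 'a set" and k
  \<comment> \<open>\<open>G\<close> reverses inclusion, \<open>R\<close> preserves it, and the
    complement in \<open>U\<close> reverses it again.\<close>
  have "mono F"
  proof (rule monoI)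
    fix X Y :: "'k \<Rightarrow> 'a set" assume "X \<le> Y"
    then have "D k (X k) \<subseteq> D k (Y k)" if "k \<in> K" for k
      using D_mono that by (simp add: le_fun_def)
    then have "G Y k \<subseteq> G X k" for k unfolding G_def by auto
    then have "R (G Y) k \<subseteq> R (G X) k" for k unfolding R_def by blast
    then show "F X \<le> F Y" unfolding F_def le_fun_def by blast
  qed
  define X where "X = lfp F"
  define Y where "Y = G X"
  have X: "X k = U k - R Y k" for k
  proof -
    have "X = F X" unfolding X_def by (rule lfp_unfold[OF \<open>mono F\<close>])
    then show ?thesis using F_def Y_def by metis
  qed
  have Y: "Y k = U k - D k (X k)" if "k \<in> K" for k using that by (simp add: Y_def G_def)
  have UE: "U k \<subseteq> E" for k using PE unfolding U_def I_def by auto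
  \<comment> \<open>By the fixed point equations these are the pairs that neither side
    rejects.\<close>
  define S where "S k = X k - D k (X k)" for k
  have S_Y: "S k = Y k - R Y k" if "k \<in> K" for k using X Y that unfolding S_def by blast
  have XE: "X k \<subseteq> E" for k using X UE by blast
  have S_base: "maximal_in (M k) (S k)" if k: "k \<in> K" for k
  proof -
    \<comment> \<open>No element rejects the index that packs it, so \<open>X k\<close> contains a
      base and its maximal independent subset \<open>S k\<close> is one.\<close>
    have "P k \<subseteq> X k" using X k unfolding R_def U_def by auto
    then show ?thesis
      using maximal_in_spanning_superset[OF _ Pb[OF k] D_base[OF k XE]] m k
      unfolding S_def by blast
  qed
  have S_disj: "S j \<inter> S k = {}" if jk: "j \<in> K" "k \<in> K" "j \<noteq> k" for j k
  proof (rule ccontr)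
    assume "S j \<inter> S k \<noteq> {}"
    then obtain e where e: "e \<in> Y j" "e \<in> Y k" "e \<notin> R Y j" "e \<notin> R Y k"
      using S_Y jk by blast
    then have "e \<in> I j \<union> P j" "e \<in> I k \<union> P k" using Y jk unfolding U_def by auto
    \<comment> \<open>The covering index of \<open>e\<close> is unique, so at least one of the two
      memberships comes from the packing. The other index escapes rejection by \<open>e\<close> only
      if it packs \<open>e\<close> too.\<close>
    then have "e \<in> P j \<or> e \<in> P k" using jk unfolding I_def by blast
    then have "e \<in> P j \<and> e \<in> P k" using e jk unfolding R_def by blast
    then show False using Pdisj jk by blast
  qed
  have "E \<subseteq> (\<Union>k\<in>K. S k)"
  proof
    fix e assume e: "e \<in> E"
    let ?k = "c e"
    have k: "?k \<in> K" "e \<in> I ?k" using c e unfolding I_def by blast+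
    then have eY: "e \<in> Y ?k" using Y D_I[OF k(1), of "X ?k"] unfolding U_def by auto
    \<comment> \<open>If \<open>e\<close> turns down its covering index, then its packing index
      wants it, and \<open>e\<close> never rejects that one.\<close>
    show "e \<in> (\<Union>k\<in>K. S k)"
    proof (cases "e \<in> R Y ?k")
      case False
      then show ?thesis using S_Y k eY by blast
    next
      case True
      then obtain j where "j \<in> K" "e \<in> P j" "e \<in> Y j" unfolding R_def by blast
      then show ?thesis using S_Y unfolding R_def by blast
    qed
  qed
  moreover have "(\<Union>k\<in>K. S k) \<subseteq> E" using XE unfolding S_def by blast
  ultimately have "base_partitioning E K M S"
    using S_base S_disj unfolding base_partitioning_def bases_def by blast
  then show ?thesis by blast
qed

theorem theorem1p2:
  fixes E :: "'a set" and K :: "'k set" and M :: "'k \<Rightarrow> 'a set set"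
  assumes "\<forall>i\<in>K. matroid E (M i)"
    and "\<forall>i\<in>K. finitary E (M i) \<or> cofinitary E (M i)"
  shows "(\<exists>B. base_partitioning E K M B) \<longleftrightarrow>
         ((\<exists>B. base_covering E K M B) \<and> (\<exists>B. base_packing E K M B))"
proof
  assume "\<exists>B. base_partitioning E K M B"
  then show "(\<exists>B. base_covering E K M B) \<and> (\<exists>B. base_packing E K M B)"
    unfolding base_partitioning_def base_covering_def base_packing_def by blast
next
  assume "(\<exists>B. base_covering E K M B) \<and> (\<exists>B. base_packing E K M B)"
  then show "\<exists>B. base_partitioning E K M B"
    using base_partitioning_from_packing_covering[OF assms] by blast
qed

end
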